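(* Consider the system $$\dot y=A(s)y,\qquad \dot s=1,\qquad y\in\mathbb R,\ s\in\mathbb S^1,$$ where $A(s)$ is a $2\pi$-periodic function. Any function $F(y,s)$ that is analytic in $y$ and $L^2$ in $s$ can be expanded into eigenfunctions of the associated Koopman operator as $$F(y,s)=\sum_{m=0}^\infty\sum_{n=-\infty}^\infty a_{mn}\,y^m e^{-m\int_0^s(A(\bar s)-A^* )d\bar s}e^{ins},$$ where $a_{mn}$ are constants, $$A^*=\frac1{2\pi}\int_0^{2\pi}A(z)\,dz,$$ and $$y^me^{-m\int_0^s(A(\bar s)-A^* )d\bar s}e^{ins}$$ is an eigenfunction of the Koopman operator corresponding to the eigenvalue $e^{(mA^*+in)t}$.
   Context: The Koopman operator family is $U^tf=f\circ S^t$, $S^t$ the flow; $\phi$ is an eigenfunction with eigenvalue $e^{\lambda t}$ if $U^t\phi=e^{\lambda t}\phi$ for all $t$. "Analytic in $y$ and $L^2$ in $s$" means $F(y,s)=\sum_{m\ge0}a_m(s)y^m$ with $a_m$ $2\pi$-periodic and square integrable. Convergence of the spectral series is pointwise in $y$ and in $L^2$ in $s$. The system arises from a $C^2$ planar vector field with a stable limit cycle, so $A$ may be taken continuous. *)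

theory Defs
  imports "HOL-Analysis.Analysis"
begin

text \<open>
  Points of the cylinder are written as pairs \<open>(y, s)\<close> in the universal cover
  \<open>real \<times> real\<close>. Functions on the cylinder are the functions on the cover that
  are \<open>2 * pi\<close>-periodic in \<open>s\<close>.
\<close>

definition periodic :: "(real \<Rightarrow> 'a) \<Rightarrow> bool" where
  "periodic f \<longleftrightarrow> (\<forall>s. f (s + 2 * pi) = f s)"

definition observable :: "(real \<times> real \<Rightarrow> complex) \<Rightarrow> bool" where
  "observable f \<longleftrightarrow> (\<forall>y. periodic (\<lambda>s. f (y, s)))"


section \<open>Flow and Koopman operators\<close>

definition solution :: "('a::real_normed_vector \<Rightarrow> 'a) \<Rightarrow> 'a \<Rightarrow> (real \<Rightarrow> 'a) \<Rightarrow> bool" where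
  "solution V p x \<longleftrightarrow> x 0 = p \<and> (\<forall>t. (x has_vector_derivative V (x t)) (at t))"

text \<open>
  Only meaningful if every initial value problem has exactly one global solution; see
  \<open>ex1_solution\<close> below for the vector field of interest.
\<close>

definition flow :: "('a::real_normed_vector \<Rightarrow> 'a) \<Rightarrow> real \<Rightarrow> 'a \<Rightarrow> 'a" where
  "flow V t p = (THE x. solution V p x) t"

definition koopman ::
    "('a::real_normed_vector \<Rightarrow> 'a) \<Rightarrow> real \<Rightarrow> ('a \<Rightarrow> complex) \<Rightarrow> 'a \<Rightarrow> complex" where
  "koopman V t f = f \<circ> flow V t"

text \<open>The eigenvalue of the operator at time \<open>t\<close> is \<open>exp (\<mu> * t)\<close>.\<close>

definition koopman_eigenfunction ::
    "(real \<times> real \<Rightarrow> real \<times> real) \<Rightarrow> (real \<times> real \<Rightarrow> complex) \<Rightarrow> complex \<Rightarrow> bool" where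
  "koopman_eigenfunction V \<phi> \<mu> \<longleftrightarrow>
     observable \<phi> \<and> (\<exists>p. \<phi> p \<noteq> 0) \<and>
     (\<forall>t. koopman V t \<phi> = (\<lambda>p. exp (\<mu> * of_real t) * \<phi> p))"


section \<open>Mean-square convergence on the circle\<close>

abbreviation circle_measure :: "real measure" where
  "circle_measure \<equiv> lebesgue_on {0..2 * pi}"

definition L2 :: "(real \<Rightarrow> complex) \<Rightarrow> bool" where
  "L2 f \<longleftrightarrow> f \<in> borel_measurable circle_measure \<and>
     integrable circle_measure (\<lambda>s. (cmod (f s))\<^sup>2)"

definition L2_norm :: "(real \<Rightarrow> complex) \<Rightarrow> real" where
  "L2_norm f = sqrt (\<integral>s. (cmod (f s))\<^sup>2 \<partial>circle_measure)"

definition L2_tendsto ::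
    "('i \<Rightarrow> real \<Rightarrow> complex) \<Rightarrow> (real \<Rightarrow> complex) \<Rightarrow> 'i filter \<Rightarrow> bool" where
  "L2_tendsto f g \<F> \<longleftrightarrow>
     (\<forall>i. L2 (f i)) \<and> L2 g \<and> ((\<lambda>i. L2_norm (\<lambda>s. f i s - g s)) \<longlongrightarrow> 0) \<F>"

definition L2_sums :: "(nat \<Rightarrow> real \<Rightarrow> complex) \<Rightarrow> (real \<Rightarrow> complex) \<Rightarrow> bool" where
  "L2_sums f g \<longleftrightarrow> L2_tendsto (\<lambda>M s. \<Sum>m<M. f m s) g sequentially"

text \<open>
  Series over all integers converge unconditionally, hence in particular along the
  partial sums over \<open>{-N..N}\<close>.
\<close>

definition L2_bisums :: "(int \<Rightarrow> real \<Rightarrow> complex) \<Rightarrow> (real \<Rightarrow> complex) \<Rightarrow> bool" where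
  "L2_bisums f g \<longleftrightarrow> L2_tendsto (\<lambda>N s. \<Sum>n\<in>N. f n s) g (finite_subsets_at_top UNIV)"

text \<open>The iterated series, summed over \<open>n\<close> first and then over \<open>m\<close>.\<close>

definition L2_double_sums ::
    "(nat \<Rightarrow> int \<Rightarrow> real \<Rightarrow> complex) \<Rightarrow> (real \<Rightarrow> complex) \<Rightarrow> bool" where
  "L2_double_sums f g \<longleftrightarrow> (\<exists>G. (\<forall>m. L2_bisums (f m) (G m)) \<and> L2_sums G g)"

text \<open>
  The power series in \<open>y\<close> converges in mean square over \<open>s\<close>, for every fixed \<open>y\<close>.
  Convergence for almost every \<open>s\<close> would not do: the series need not converge in mean
  square then, even if each \<open>F (y, _)\<close> is square integrable.
\<close>

definition analytic_L2 :: "(real \<times> real \<Rightarrow> complex) \<Rightarrow> bool" where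
  "analytic_L2 F \<longleftrightarrow> observable F \<and>
     (\<exists>a. (\<forall>m. periodic (a m) \<and> L2 (a m)) \<and>
          (\<forall>y. L2_sums (\<lambda>m s. a m s * of_real y ^ m) (\<lambda>s. F (y, s))))"


section \<open>The linear system along the cycle\<close>

definition cycle_field :: "(real \<Rightarrow> real) \<Rightarrow> real \<times> real \<Rightarrow> real \<times> real" where
  "cycle_field A = (\<lambda>(y, s). (A s * y, 1))"

definition mean :: "(real \<Rightarrow> real) \<Rightarrow> real" where
  "mean A = 1 / (2 * pi) * (LBINT z=0..2 * pi. A z)"

text \<open>The interval integral is signed, so negative \<open>s\<close> is covered.\<close>

definition mode :: "(real \<Rightarrow> real) \<Rightarrow> nat \<Rightarrow> int \<Rightarrow> real \<times> real \<Rightarrow> complex" where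
  "mode A m n = (\<lambda>(y, s).
     of_real (y ^ m * exp (- real m * (LBINT z=0..s. A z - mean A))) *
     exp (\<i> * of_int n * of_real s))"

lemma ex1_solution:
  assumes A: "continuous_on UNIV A"
  shows "\<exists>!x. solution (cycle_field A) p x"
proof -
  obtain y s where p: "p = (y, s)" by (cases p)
  define B where "B t = (LBINT z=s..s + t. A z)" for t :: real
  have B: "(B has_real_derivative A (s + t)) (at t)" for t
  proof -
    define a b where "a = min s (s + t) - 1" and "b = max s (s + t) + 1"
    have "((\<lambda>u. LBINT z=s..u. A z) has_vector_derivative A (s + t)) (at (s + t) within {a..b})"
      by (rule interval_integral_FTC2)
         (auto simp: a_def b_def intro: continuous_on_subset[OF A])
    moreover have "at (s + t) within {a..b} = at (s + t)"
      by (rule at_within_Icc_at) (auto simp: a_def b_def)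
    ultimately have "((\<lambda>u. LBINT z=s..u. A z) has_real_derivative A (s + t)) (at (s + t))"
      by (simp add: has_real_derivative_iff_has_vector_derivative)
    then have "((\<lambda>t. LBINT z=s..(s + t). A z) has_real_derivative A (s + t) * 1) (at t)"
      by (rule DERIV_chain2) (auto intro!: derivative_eq_intros)
    then show ?thesis by (simp add: B_def[abs_def])
  qed
  have B0: "B 0 = 0" by (simp add: B_def)
  define x where "x t = (y * exp (B t), s + t)" for t
  have "solution (cycle_field A) p x"
    unfolding solution_def
  proof (intro conjI allI)
    fix t
    have "((\<lambda>t. y * exp (B t)) has_real_derivative A (s + t) * (y * exp (B t))) (at t)"
      by (auto intro!: derivative_eq_intros B)
    then have "(x has_vector_derivative (A (s + t) * (y * exp (B t)), 1)) (at t)"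
      unfolding x_def
      by (intro has_vector_derivative_Pair)
         (auto simp: has_real_derivative_iff_has_vector_derivative intro!: derivative_eq_intros)
    then show "(x has_vector_derivative cycle_field A (x t)) (at t)"
      by (simp add: x_def cycle_field_def)
  qed (simp add: x_def p B0)
  moreover have "z = x" if z: "solution (cycle_field A) p z" for z
  proof -
    have z': "(z has_derivative (\<lambda>h. h *\<^sub>R cycle_field A (z t))) (at t)" for t
      using z by (simp add: solution_def has_vector_derivative_def)
    have f: "((\<lambda>t. fst (z t)) has_real_derivative A (snd (z t)) * fst (z t)) (at t)" for t
      using has_derivative_fst[OF z'[of t]]
      by (simp add: has_real_derivative_iff_has_vector_derivative has_vector_derivative_def
          cycle_field_def case_prod_beta)
    have g: "((\<lambda>t. snd (z t)) has_real_derivative 1) (at t)" for t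
      using has_derivative_snd[OF z'[of t]]
      by (simp add: has_real_derivative_iff_has_vector_derivative has_vector_derivative_def
          cycle_field_def case_prod_beta)
    have "((\<lambda>t. snd (z t) - t) has_real_derivative 0) (at t)" for t
      by (auto intro!: derivative_eq_intros g)
    then have "snd (z t) - t = snd (z 0) - 0" for t
      using DERIV_isconst_all[of "\<lambda>t. snd (z t) - t"] by blast
    then have snd: "snd (z t) = s + t" for t
      using z by (simp add: solution_def p algebra_simps)
    have "((\<lambda>t. fst (z t) * exp (- B t)) has_real_derivative 0) (at t)" for t
      by (auto intro!: derivative_eq_intros f B simp: snd)
    then have "fst (z t) * exp (- B t) = fst (z 0) * exp (- B 0)" for t
      using DERIV_isconst_all[of "\<lambda>t. fst (z t) * exp (- B t)"] by blast
    then have "fst (z t) = y * exp (B t)" for t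
      using z by (simp add: solution_def p B0 exp_minus field_simps)
    with snd show ?thesis by (auto simp: x_def fun_eq_iff prod_eq_iff)
  qed
  ultimately show ?thesis by blast
qed

end

theory Submission
  imports Defs
begin

text \<open>
  Put \<open>P s = \<integral>\<^sub>0\<^sup>s (A - A\<^sup>*)\<close>, a continuous \<open>2 * pi\<close>-periodic function. The flow is
  \<open>(y, s) \<mapsto> (y * exp (P (s + t) - P s + A\<^sup>* * t), s + t)\<close>, which makes the eigenfunction
  equation a computation. For the expansion, \<open>exp (m * P)\<close> is bounded on the circle, so
  \<open>a\<^sub>m * exp (m * P)\<close> is square integrable, and multiplying its Fourier series by the bounded
  function \<open>y ^ m * exp (- m * P)\<close> preserves mean-square convergence. The Fourier series
  converges because its partial sums are best approximations and trigonometric polynomials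
  are dense in \<open>L\<^sup>2\<close>, by Stone-Weierstrass on the unit circle.
\<close>

section \<open>Square integrable functions on the circle\<close>

text \<open>Estimates are made for the square of the norm, where integrals add; the root is taken
  only once, in \<open>L2_bisums_fourier\<close>.\<close>

definition mean_square :: "(real \<Rightarrow> complex) \<Rightarrow> real" where
  "mean_square f = (\<integral>s. (cmod (f s))\<^sup>2 \<partial>circle_measure)"

lemma L2_norm_eq: "L2_norm f = sqrt (mean_square f)"
  by (simp add: L2_norm_def mean_square_def)

lemma mean_square_nonneg: "0 \<le> mean_square f"
  unfolding mean_square_def by (rule Bochner_Integration.integral_nonneg) simp

lemma L2_measurable: "L2 f \<Longrightarrow> f \<in> borel_measurable circle_measure"
  by (simp add: L2_def)

lemma L2_integrable: "L2 f \<Longrightarrow> integrable circle_measure (\<lambda>s. (cmod (f s))\<^sup>2)"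
  by (simp add: L2_def)

text \<open>Follows from \<open>2 * a * b \<le> a\<^sup>2 + b\<^sup>2\<close>. It serves as the
  triangle inequality for \<open>mean_square\<close>, at the price of a factor 2.\<close>

lemma cmod_add_squared_le: "(cmod (z + w))\<^sup>2 \<le> 2 * (cmod z)\<^sup>2 + 2 * (cmod w)\<^sup>2"
proof -
  have "(cmod (z + w))\<^sup>2 \<le> (cmod z + cmod w)\<^sup>2"
    by (intro power_mono norm_triangle_ineq) simp
  also have "\<dots> \<le> 2 * (cmod z)\<^sup>2 + 2 * (cmod w)\<^sup>2"
    using sum_squares_bound[of "cmod z" "cmod w"] by (simp add: power2_sum)
  finally show ?thesis .
qed

lemma L2_add:
  assumes "L2 f" "L2 g"
  shows "L2 (\<lambda>s. f s + g s)"
proof -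
  note [measurable] = L2_measurable[OF assms(1)] L2_measurable[OF assms(2)]
  have "integrable circle_measure (\<lambda>s. 2 * (cmod (f s))\<^sup>2 + 2 * (cmod (g s))\<^sup>2)"
    using assms by (simp add: L2_integrable)
  then have "integrable circle_measure (\<lambda>s. (cmod (f s + g s))\<^sup>2)"
    by (rule Bochner_Integration.integrable_bound) (auto simp: cmod_add_squared_le)
  then show ?thesis by (simp add: L2_def)
qed

text \<open>Pointwise domination by \<open>K\<^sup>2 * (cmod (f s))\<^sup>2\<close>. The second part
  makes multiplication by a bounded weight continuous in mean square, so it can be applied termwise
  to a Fourier series.\<close>

lemma L2_mult_bounded:
  assumes f: "L2 f" and [measurable]: "h \<in> borel_measurable circle_measure"
    and h: "\<And>s. s \<in> {0..2 * pi} \<Longrightarrow> cmod (h s) \<le> K"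
  shows "L2 (\<lambda>s. h s * f s)"
    and "mean_square (\<lambda>s. h s * f s) \<le> K\<^sup>2 * mean_square f"
proof -
  note [measurable] = L2_measurable[OF f]
  have le: "(cmod (h s * f s))\<^sup>2 \<le> K\<^sup>2 * (cmod (f s))\<^sup>2" if "s \<in> {0..2 * pi}" for s
    using h[OF that] by (simp add: norm_mult power_mult_distrib mult_right_mono power_mono)
  have K: "integrable circle_measure (\<lambda>s. K\<^sup>2 * (cmod (f s))\<^sup>2)"
    using f by (simp add: L2_integrable)
  then have int: "integrable circle_measure (\<lambda>s. (cmod (h s * f s))\<^sup>2)"
    by (rule Bochner_Integration.integrable_bound) (auto intro!: AE_I2 simp: space_restrict_space le)
  then show "L2 (\<lambda>s. h s * f s)" by (simp add: L2_def)
  have "mean_square (\<lambda>s. h s * f s) \<le> (\<integral>s. K\<^sup>2 * (cmod (f s))\<^sup>2 \<partial>circle_measure)"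
    unfolding mean_square_def by (rule integral_mono[OF int K]) (simp add: space_restrict_space le)
  then show "mean_square (\<lambda>s. h s * f s) \<le> K\<^sup>2 * mean_square f"
    by (simp add: mean_square_def)
qed

lemma L2_cmult: "L2 f \<Longrightarrow> L2 (\<lambda>s. c * f s)"
  by (rule L2_mult_bounded(1)[where K = "cmod c"]) auto

lemma L2_diff: "L2 f \<Longrightarrow> L2 g \<Longrightarrow> L2 (\<lambda>s. f s - g s)"
  using L2_add[of f "\<lambda>s. - 1 * g s"] L2_cmult[of g "- 1"] by simp

lemma L2_bounded:
  assumes [measurable]: "f \<in> borel_measurable circle_measure"
    and "\<And>s. s \<in> {0..2 * pi} \<Longrightarrow> cmod (f s) \<le> K"
  shows "L2 f"
proof -
  have "L2 (\<lambda>_. 1)" by (simp add: L2_def)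
  from L2_mult_bounded(1)[OF this assms] show ?thesis by simp
qed

lemma continuous_imp_circle_measurable:
  "continuous_on {0..2 * pi} f \<Longrightarrow> f \<in> borel_measurable circle_measure"
  by (simp add: continuous_imp_measurable_on_sets_lebesgue)

lemma L2_continuous:
  assumes "continuous_on {0..2 * pi} f"
  shows "L2 f"
proof -
  have "bounded (f ` {0..2 * pi})"
    using assms by (intro compact_imp_bounded compact_continuous_image) auto
  then obtain K where "\<And>s. s \<in> {0..2 * pi} \<Longrightarrow> cmod (f s) \<le> K"
    unfolding bounded_iff by blast
  with assms show ?thesis
    by (intro L2_bounded continuous_imp_circle_measurable)
qed

lemma L2_sum: "(\<And>i. i \<in> I \<Longrightarrow> L2 (f i)) \<Longrightarrow> L2 (\<lambda>s. \<Sum>i\<in>I. f i s)"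
\<comment> \<open>An infinite index set is included, with sum 0 by convention, because
  \<open>L2_tendsto\<close> asks for square integrability at every index, and
  \<open>L2_bisums\<close> indexes by all sets of integers.\<close>
proof (induction I rule: infinite_finite_induct)
  case (insert i I)
  then show ?case by (simp add: L2_add)
qed (simp_all add: L2_continuous)

lemma mean_square_add_le:
  assumes "L2 f" "L2 g"
  shows "mean_square (\<lambda>s. f s + g s) \<le> 2 * mean_square f + 2 * mean_square g"
proof -
  have "mean_square (\<lambda>s. f s + g s)
      \<le> (\<integral>s. 2 * (cmod (f s))\<^sup>2 + 2 * (cmod (g s))\<^sup>2 \<partial>circle_measure)"
    unfolding mean_square_def
    by (intro integral_mono L2_integrable[OF L2_add[OF assms]])
       (simp_all add: L2_integrable assms cmod_add_squared_le)
  also have "\<dots> = 2 * mean_square f + 2 * mean_square g"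
    using assms by (simp add: mean_square_def L2_integrable)
  finally show ?thesis .
qed

text \<open>The product is dominated by the sum of the two squared moduli. This makes the inner
  product of two square integrable functions meaningful.\<close>

lemma L2_inner_integrable:
  assumes "L2 f" "L2 g"
  shows "integrable circle_measure (\<lambda>s. f s * cnj (g s))"
proof -
  note [measurable] = L2_measurable[OF assms(1)] L2_measurable[OF assms(2)]
  have "integrable circle_measure (\<lambda>s. (cmod (f s))\<^sup>2 + (cmod (g s))\<^sup>2)"
    using assms by (simp add: L2_integrable)
  moreover have "cmod z * cmod w \<le> (cmod z)\<^sup>2 + (cmod w)\<^sup>2" for z w
    using sum_squares_bound[of "cmod z" "cmod w"] mult_nonneg_nonneg[OF norm_ge_zero norm_ge_zero, of z w]
    by linarith
  moreover have "(\<lambda>s. f s * cnj (g s)) \<in> borel_measurable circle_measure"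
    by (intro borel_measurable_times borel_measurable_continuous_on[where f = cnj]
        continuous_intros) measurable
  ultimately show ?thesis
    by (rule_tac Bochner_Integration.integrable_bound) (auto simp: norm_mult)
qed


section \<open>Fourier series\<close>

definition wave :: "int \<Rightarrow> real \<Rightarrow> complex" where
  "wave n s = exp (\<i> * of_int n * of_real s)"

lemma wave_mult: "wave m s * wave n s = wave (m + n) s"
  by (simp add: wave_def algebra_simps flip: exp_add)

lemma cnj_wave: "cnj (wave n s) = wave (- n) s"
  by (simp add: wave_def exp_cnj)

lemma continuous_on_wave: "continuous_on S (wave n)"
  unfolding wave_def by (intro continuous_intros)

lemma L2_wave: "L2 (wave n)"
  by (intro L2_continuous continuous_on_wave)

text \<open>Orthogonality of the waves, since \<open>wave m s * cnj (wave n s)\<close> is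
  \<open>wave (m - n) s\<close>. The waves are not normalised: each has mean square
  \<open>2 * pi\<close>, which is why \<open>fourier_coeff\<close> divides by it.\<close>

lemma integral_wave:
  "(\<integral>s. wave n s \<partial>circle_measure) = (if n = 0 then of_real (2 * pi) else 0)"
proof -
  have "integrable circle_measure (wave n)"
    using L2_inner_integrable[OF L2_wave[of n] L2_wave[of 0]] by (simp add: wave_def[abs_def])
  then have eq: "(\<integral>s. wave n s \<partial>circle_measure) = integral {0..2 * pi} (wave n)"
    by (rule lebesgue_integral_eq_integral) simp
  show ?thesis
  proof (cases "n = 0")
    case True
    then have "wave n = (\<lambda>_. 1)" by (simp add: wave_def fun_eq_iff)
    then show ?thesis using True by (simp add: measure_restrict_space scaleR_conv_of_real)
  next
    case False
    have "(wave n has_integral wave n (2 * pi) / (\<i> * of_int n) - wave n 0 / (\<i> * of_int n))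
        {0..2 * pi}"
    proof (rule fundamental_theorem_of_calculus)
      fix s :: real
      have "((\<lambda>z. exp (\<i> * of_int n * z) / (\<i> * of_int n)) has_field_derivative
          exp (\<i> * of_int n * of_real s)) (at (of_real s))"
        using False by (auto intro!: derivative_eq_intros)
      from has_vector_derivative_real_field[OF this, of "{0..2 * pi}"]
      show "((\<lambda>s. wave n s / (\<i> * of_int n)) has_vector_derivative wave n s)
          (at s within {0..2 * pi})"
        by (simp add: wave_def[abs_def])
    qed simp
    moreover have "wave n (2 * pi) = 1"
      using exp_integer_2pi[of "of_int n"]
      by (simp add: wave_def algebra_simps)
    ultimately have "(wave n has_integral 0) {0..2 * pi}"
      by (simp add: wave_def)
    then show ?thesis using False by (simp add: eq integral_unique)
  qed
qed

section \<open>Fourier coefficients and best approximation\<close>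

definition fourier_coeff :: "(real \<Rightarrow> complex) \<Rightarrow> int \<Rightarrow> complex" where
  "fourier_coeff f n = (\<integral>s. f s * cnj (wave n s) \<partial>circle_measure) / of_real (2 * pi)"

lemma L2_trig_sum: "L2 (\<lambda>s. \<Sum>n\<in>N. c n * wave n s)"
  by (intro L2_sum L2_cmult L2_wave)

lemma fourier_remainder_orthogonal:
  assumes f: "L2 f" and N: "finite N" "n \<in> N"
  shows "(\<integral>s. (f s - (\<Sum>k\<in>N. fourier_coeff f k * wave k s)) * cnj (wave n s) \<partial>circle_measure) = 0"
proof -
  have int: "integrable circle_measure (\<lambda>s. wave k s * cnj (wave n s))" for k
    by (intro L2_inner_integrable L2_wave)
  have "(\<integral>s. (f s - (\<Sum>k\<in>N. fourier_coeff f k * wave k s)) * cnj (wave n s) \<partial>circle_measure)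
      = (\<integral>s. f s * cnj (wave n s)
          - (\<Sum>k\<in>N. fourier_coeff f k * (wave k s * cnj (wave n s))) \<partial>circle_measure)"
    by (simp add: left_diff_distrib sum_distrib_right mult.assoc)
  also have "\<dots> = (\<integral>s. f s * cnj (wave n s) \<partial>circle_measure)
      - (\<Sum>k\<in>N. fourier_coeff f k * (\<integral>s. wave k s * cnj (wave n s) \<partial>circle_measure))"
    using int L2_inner_integrable[OF f L2_wave] by simp
  also have "(\<Sum>k\<in>N. fourier_coeff f k * (\<integral>s. wave k s * cnj (wave n s) \<partial>circle_measure))
      = (\<Sum>k\<in>N. if k = n then fourier_coeff f k * of_real (2 * pi) else 0)"
    by (intro sum.cong) (auto simp: cnj_wave wave_mult integral_wave)
  also have "\<dots> = (\<integral>s. f s * cnj (wave n s) \<partial>circle_measure)"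
    using N by (simp add: fourier_coeff_def)
  finally show ?thesis by simp
qed

text \<open>Pythagoras: the remainder \<open>h\<close> is orthogonal to every wave in
  \<open>N\<close>, hence to the difference \<open>q\<close> between the Fourier sum and the
  competing sum; so the competitor's error \<open>h + q\<close> exceeds that of \<open>h\<close> by
  \<open>mean_square q\<close>.\<close>

lemma fourier_best_approximation:
  assumes f: "L2 f" and N: "finite N"
  shows "mean_square (\<lambda>s. f s - (\<Sum>n\<in>N. fourier_coeff f n * wave n s))
    \<le> mean_square (\<lambda>s. f s - (\<Sum>n\<in>N. d n * wave n s))"
proof -
  define h where "h s = f s - (\<Sum>n\<in>N. fourier_coeff f n * wave n s)" for s
  define q where "q s = (\<Sum>n\<in>N. (fourier_coeff f n - d n) * wave n s)" for s
  have h: "L2 h" unfolding h_def by (intro L2_diff f L2_trig_sum)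
  have q: "L2 q" unfolding q_def by (rule L2_trig_sum)
  have "(\<integral>s. h s * cnj (q s) \<partial>circle_measure)
      = (\<integral>s. (\<Sum>n\<in>N. cnj (fourier_coeff f n - d n) * (h s * cnj (wave n s))) \<partial>circle_measure)"
    by (simp add: q_def sum_distrib_left mult_ac)
  also have "\<dots> = (\<Sum>n\<in>N. cnj (fourier_coeff f n - d n) *
      (\<integral>s. h s * cnj (wave n s) \<partial>circle_measure))"
    using L2_inner_integrable[OF h L2_wave] by simp
  also have "\<dots> = 0"
    using fourier_remainder_orthogonal[OF f N] by (simp add: h_def)
  finally have orth: "(\<integral>s. Re (h s * cnj (q s)) \<partial>circle_measure) = 0"
    by (subst integral_Re[OF L2_inner_integrable[OF h q]]) simp
  have re: "integrable circle_measure (\<lambda>s. Re (h s * cnj (q s)))"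
    by (intro integrable_Re L2_inner_integrable h q)
  have re2: "integrable circle_measure (\<lambda>s. 2 * Re (h s * cnj (q s)))"
    using re by (rule integrable_mult_right)
  have pyth: "(cmod (h s + q s))\<^sup>2 = (cmod (h s))\<^sup>2 + (cmod (q s))\<^sup>2 + 2 * Re (h s * cnj (q s))" for s
    unfolding cmod_power2 by (simp add: power2_eq_square algebra_simps)
  have "mean_square (\<lambda>s. h s + q s) = mean_square h + mean_square q"
    unfolding mean_square_def pyth
    by (subst Bochner_Integration.integral_add[OF _ re2],
        intro Bochner_Integration.integrable_add L2_integrable h q,
        subst Bochner_Integration.integral_add[OF L2_integrable[OF h] L2_integrable[OF q]],
        simp only: integral_mult_right_zero orth mult_zero_right add_0_right)
  moreover have "(\<lambda>s. h s + q s) = (\<lambda>s. f s - (\<Sum>n\<in>N. d n * wave n s))"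
    by (simp add: h_def q_def left_diff_distrib sum_subtractf)
  ultimately have "mean_square h \<le> mean_square (\<lambda>s. f s - (\<Sum>n\<in>N. d n * wave n s))"
    using mean_square_nonneg[of q] by simp
  then show ?thesis by (simp only: h_def[abs_def])
qed

section \<open>Uniform approximation by trigonometric polynomials\<close>

inductive trig_polynomial :: "(real \<Rightarrow> complex) \<Rightarrow> bool" where
  monom: "trig_polynomial (\<lambda>s. c * wave n s)"
| add: "trig_polynomial f \<Longrightarrow> trig_polynomial g \<Longrightarrow> trig_polynomial (\<lambda>s. f s + g s)"

lemma trig_polynomial_const: "trig_polynomial (\<lambda>_. c)"
  using trig_polynomial.monom[of c 0] by (simp add: wave_def)

lemma trig_polynomial_mult:
  assumes "trig_polynomial f" "trig_polynomial g"
  shows "trig_polynomial (\<lambda>s. f s * g s)"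
  using assms(1)
proof induction
  case f: (monom c m)
  show ?case using assms(2)
  proof induction
    case (monom d n)
    show ?case using trig_polynomial.monom[of "c * d" "m + n"]
      by (simp add: mult_ac flip: wave_mult)
  next
    case (add g h)
    then show ?case using trig_polynomial.add[OF add.IH] by (simp add: distrib_left)
  qed
next
  case (add f h)
  then show ?case using trig_polynomial.add[OF add.IH] by (simp add: distrib_right)
qed

text \<open>The inductive form suits closure under products; here equal frequencies are merged,
  giving the indexed sums with which Fourier sums are compared.\<close>

lemma trig_polynomial_sum:
  assumes "trig_polynomial f"
  obtains N c where "finite N" "f = (\<lambda>s. \<Sum>n\<in>N. c n * wave n s)"
proof -
  from assms have "\<exists>N c. finite N \<and> f = (\<lambda>s. \<Sum>n\<in>N. c n * wave n s)"
  proof induction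
    case (monom c n)
    show ?case by (rule exI[of _ "{n}"], rule exI[of _ "\<lambda>_. c"]) simp
  next
    case (add f g)
    then obtain N c M d where N: "finite N" "f = (\<lambda>s. \<Sum>n\<in>N. c n * wave n s)"
      and M: "finite M" "g = (\<lambda>s. \<Sum>n\<in>M. d n * wave n s)" by blast
    define b where "b n = (if n \<in> N then c n else 0) + (if n \<in> M then d n else 0)" for n
    have "(\<Sum>n\<in>N. c n * wave n s) = (\<Sum>n\<in>N \<union> M. (if n \<in> N then c n else 0) * wave n s)" for s
      using N M by (intro sum.mono_neutral_cong_left) auto
    moreover have "(\<Sum>n\<in>M. d n * wave n s) = (\<Sum>n\<in>N \<union> M. (if n \<in> M then d n else 0) * wave n s)" for s
      using N M by (intro sum.mono_neutral_cong_left) auto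
    ultimately have "(\<lambda>s. f s + g s) = (\<lambda>s. \<Sum>n\<in>N \<union> M. b n * wave n s)"
      by (simp add: N M b_def distrib_right sum.distrib)
    with N M show ?case by blast
  qed
  with that show thesis by blast
qed

text \<open>Restricted to the unit circle, a real linear form is a combination of cosine and sine,
  hence of \<open>wave 1\<close> and \<open>wave (- 1)\<close>; sums and products then follow by
  closure.\<close>

lemma trig_polynomial_real_polynomial_function:
  fixes p :: "complex \<Rightarrow> real"
  assumes "real_polynomial_function p"
  shows "trig_polynomial (\<lambda>s. of_real (p (cis s)))"
  using assms
proof induction
  case (linear p)
  interpret bounded_linear p by fact
  \<comment> \<open>Euler's formulas applied to \<open>cos s * p 1 + sin s * p \<i>\<close> give
    these two coefficients.\<close>
  have "of_real (p (cis s)) = (of_real (p 1) - \<i> * of_real (p \<i>)) / 2 * wave 1 s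
      + (of_real (p 1) + \<i> * of_real (p \<i>)) / 2 * wave (- 1) s" for s
  proof -
    have "cis s = cos s *\<^sub>R 1 + sin s *\<^sub>R \<i>"
      by (simp add: complex_eq_iff)
    then have "p (cis s) = cos s * p 1 + sin s * p \<i>"
      by (simp only: add scaleR real_scaleR_def)
    moreover have "wave 1 s = cis s" "wave (- 1) s = cis (- s)"
      by (simp_all add: wave_def cis_conv_exp)
    ultimately show ?thesis
      by (simp add: complex_eq_iff field_simps)
  qed
  then show ?case
    by (simp only:) (intro trig_polynomial.intros)
next
  case (const c)
  show ?case by (rule trig_polynomial_const)
next
  case (add p q)
  then show ?case by (simp add: trig_polynomial.add)
next
  case (mult p q)
  then show ?case by (simp add: trig_polynomial_mult)
qed

text \<open>Equal values at the two ends let \<open>g\<close> descend to a continuous function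
  \<open>G\<close> on the unit circle, where Stone-Weierstrass applies.\<close>

lemma trig_polynomial_uniform_approximation:
  fixes g :: "real \<Rightarrow> complex"
  assumes g: "continuous_on {0..2 * pi} g" "g 0 = g (2 * pi)" and e: "0 < e"
  obtains p where "trig_polynomial p" "\<And>s. s \<in> {0..2 * pi} \<Longrightarrow> cmod (g s - p s) < e"
proof -
  define G where "G z = g (Arg2pi z)" for z
  \<comment> \<open>\<open>Arg2pi\<close> takes values in the half-open interval, so at
    \<open>s = 2 * pi\<close> it returns 0; this is where equality of the end values enters.\<close>
  have G: "G (cis s) = g s" if "s \<in> {0..2 * pi}" for s
  proof (cases "s = 2 * pi")
    case True
    have "Arg2pi 1 = 0" using Arg2pi_of_real[of 1] by simp
    with True g(2) show ?thesis by (simp add: G_def)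
  next
    case False
    then have "Arg2pi (cis s) = s"
      using that by (intro Arg2pi_unique[of 1]) (auto simp: cis_conv_exp)
    then show ?thesis by (simp add: G_def)
  qed
  have img: "cis ` {0..2 * pi} = sphere 0 1"
  proof (intro equalityI subsetI)
    fix z :: complex assume "z \<in> sphere 0 1"
    then have "z = cis (Arg2pi z)"
      using Arg2pi_eq[of z] by (simp add: cis_conv_exp)
    then show "z \<in> cis ` {0..2 * pi}"
      using Arg2pi_ge_0[of z] Arg2pi_lt_2pi[of z] by (intro image_eqI) auto
  qed auto
  \<comment> \<open>\<open>Arg2pi\<close> jumps at 1, so continuity of \<open>G\<close> is obtained
    from \<open>G \<circ> cis\<close> instead: a continuous surjection from a compact space onto a
    Hausdorff space is a quotient map.\<close>
  have "quotient_map (top_of_set {0..2 * pi}) (top_of_set (sphere 0 1)) cis"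
    by (rule T1_Spaces.continuous_imp_quotient_map)
       (auto simp: img compact_space_subtopology Hausdorff_space_subtopology
         intro!: continuous_intros)
  moreover have "continuous_map (top_of_set {0..2 * pi}) euclidean (G \<circ> cis)"
  proof -
    have "continuous_on {0..2 * pi} (G \<circ> cis)"
      using g(1) by (rule continuous_on_eq) (simp only: o_def G)
    then show ?thesis by (simp only: continuous_map_iff_continuous)
  qed
  ultimately have "continuous_map (top_of_set (sphere 0 1)) euclidean G"
    by (rule continuous_compose_quotient_map)
  then have "continuous_on (sphere 0 1) G"
    by (simp only: continuous_map_iff_continuous)
  then obtain q where q: "polynomial_function q" "\<And>z. z \<in> sphere 0 1 \<Longrightarrow> cmod (G z - q z) < e"
    using Stone_Weierstrass_polynomial_function[of "sphere 0 1" G e] e by auto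
  show thesis
  proof
    have "real_polynomial_function (\<lambda>z. Re (q z))" "real_polynomial_function (\<lambda>z. Im (q z))"
      using q(1) bounded_linear_Re bounded_linear_Im
      unfolding polynomial_function_def o_def by blast+
    then have "trig_polynomial (\<lambda>s. of_real (Re (q (cis s))) + \<i> * of_real (Im (q (cis s))))"
      by (intro trig_polynomial.add trig_polynomial_mult trig_polynomial_const
            trig_polynomial_real_polynomial_function)
    then show "trig_polynomial (\<lambda>s. q (cis s))"
      by (simp flip: complex_eq)
    show "cmod (g s - q (cis s)) < e" if "s \<in> {0..2 * pi}" for s
      using q(2)[of "cis s"] G[OF that] by simp
  qed
qed

section \<open>Density of trigonometric polynomials in mean square\<close>

definition clip :: "real \<Rightarrow> complex \<Rightarrow> complex" where
  "clip B z = of_real (B / max B (cmod z)) * z"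

text \<open>\<open>clip B\<close> is the radial retraction of the plane onto the disc of radius
  \<open>B\<close>; its denominator is at least \<open>B\<close>, hence never zero.\<close>

lemma continuous_on_clip: "0 < B \<Longrightarrow> continuous_on S (clip B)"
  unfolding clip_def by (intro continuous_intros) (auto simp: max_def)

lemma cmod_clip_le: "0 < B \<Longrightarrow> cmod (clip B z) \<le> B"
  by (auto simp: clip_def norm_mult norm_divide max_def)

lemma clip_eq: "0 < B \<Longrightarrow> cmod z \<le> B \<Longrightarrow> clip B z = z"
  by (simp add: clip_def max_def)

lemma cmod_diff_clip_le:
  assumes "0 < B"
  shows "cmod (z - clip B z) \<le> cmod z"
proof -
  have "z - clip B z = of_real (1 - B / max B (cmod z)) * z"
    by (simp add: clip_def algebra_simps)
  moreover have "\<bar>1 - B / max B (cmod z)\<bar> \<le> 1"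
    using assms by (simp add: abs_le_iff divide_le_eq)
  ultimately show ?thesis
    by (simp only: norm_mult norm_of_real) (simp add: mult_left_le_one_le)
qed

text \<open>Dominated convergence: at each \<open>s\<close> the difference vanishes once the radius
  exceeds \<open>cmod (f s)\<close>, and its square never exceeds that of \<open>f\<close>.\<close>

lemma mean_square_diff_clip:
  assumes f: "L2 f"
  shows "(\<lambda>k. mean_square (\<lambda>s. f s - clip (real (Suc k)) (f s))) \<longlonglongrightarrow> 0"
proof -
  note [measurable] = L2_measurable[OF f]
  have clip: "(\<lambda>s. clip (real (Suc k)) (f s)) \<in> borel_measurable circle_measure" for k
    using borel_measurable_continuous_onI[OF continuous_on_clip[of "real (Suc k)"]] by measurable
  have "(\<lambda>k. \<integral>s. (cmod (f s - clip (real (Suc k)) (f s)))\<^sup>2 \<partial>circle_measure)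
      \<longlonglongrightarrow> (\<integral>s. 0 \<partial>circle_measure)"
  proof (rule integral_dominated_convergence[where w = "\<lambda>s. (cmod (f s))\<^sup>2"])
    show "AE s in circle_measure.
        (\<lambda>k. (cmod (f s - clip (real (Suc k)) (f s)))\<^sup>2) \<longlonglongrightarrow> 0"
    proof (rule AE_I2)
      fix s
      have "eventually (\<lambda>k. cmod (f s) \<le> real k) sequentially"
        using filterlim_real_sequentially by (simp add: filterlim_at_top)
      then have "eventually (\<lambda>k. (cmod (f s - clip (real (Suc k)) (f s)))\<^sup>2 = 0) sequentially"
        by eventually_elim (simp add: clip_eq)
      then show "(\<lambda>k. (cmod (f s - clip (real (Suc k)) (f s)))\<^sup>2) \<longlonglongrightarrow> 0"
        by (rule tendsto_eventually)
    qed
    show "(\<lambda>s. (cmod (f s - clip (real (Suc k)) (f s)))\<^sup>2) \<in> borel_measurable circle_measure" for k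
      using clip[of k] by measurable
    show "AE s in circle_measure.
        norm ((cmod (f s - clip (real (Suc k)) (f s)))\<^sup>2) \<le> (cmod (f s))\<^sup>2" for k
      by (intro AE_I2) (simp add: power_mono cmod_diff_clip_le del: of_nat_Suc)
  qed (simp_all add: L2_integrable[OF f])
  then show ?thesis by (simp add: mean_square_def)
qed

text \<open>
  The continuous approximants given by Lusin measurability are clipped, to make them
  dominated, and multiplied by \<open>1 - \<bar>cos (s / 2)\<bar> ^ n\<close>, to make them vanish at both ends.
\<close>

lemma bounded_approximation:
  assumes [measurable]: "f \<in> borel_measurable circle_measure"
    and B: "0 < B" "\<And>s. cmod (f s) \<le> B"
  obtains g :: "nat \<Rightarrow> real \<Rightarrow> complex"
  where "\<And>n. continuous_on UNIV (g n)" "\<And>n. g (Suc n) 0 = 0" "\<And>n. g (Suc n) (2 * pi) = 0"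
    "(\<lambda>n. mean_square (\<lambda>s. f s - g n s)) \<longlonglongrightarrow> 0"
proof -
  have "f measurable_on {0..2 * pi}"
    by (subst measurable_on_iff_borel_measurable) auto
  then obtain N g where N: "negligible N" and g: "\<And>n. continuous_on UNIV (g n)"
    and lim: "\<And>s. s \<notin> N \<Longrightarrow> (\<lambda>n. g n s) \<longlonglongrightarrow> (if s \<in> {0..2 * pi} then f s else 0)"
    unfolding measurable_on_def by blast
  define h where "h n s = of_real (1 - \<bar>cos (s / 2)\<bar> ^ n) * clip B (g n s)" for n s
  have cont: "continuous_on UNIV (h n)" for n
    unfolding h_def
    by (intro continuous_intros continuous_on_compose2[OF continuous_on_clip[OF B(1)] g]) auto
  have cont': "continuous_on {0..2 * pi} (h n)" for n
    using cont by (rule continuous_on_subset) simp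
  note [measurable] = continuous_imp_circle_measurable[OF cont']
  have bound: "cmod (h n s) \<le> B" for n s
  proof -
    have "\<bar>1 - \<bar>cos (s / 2)\<bar> ^ n\<bar> \<le> 1"
      by (simp add: abs_le_iff power_le_one)
    then have "cmod (h n s) \<le> 1 * B"
      unfolding h_def norm_mult norm_of_real
      by (intro mult_mono cmod_clip_le B) auto
    then show ?thesis by simp
  qed
  have "(\<lambda>n. \<integral>s. (cmod (f s - h n s))\<^sup>2 \<partial>circle_measure) \<longlonglongrightarrow> (\<integral>s. 0 \<partial>circle_measure)"
  proof (rule integral_dominated_convergence[where w = "\<lambda>_. (2 * B)\<^sup>2"])
    \<comment> \<open>The endpoints are discarded along with \<open>N\<close>: there the damping
      factor is 0 for every \<open>n\<close>, whereas strictly between them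
      \<open>\<bar>cos (s / 2)\<bar> < 1\<close> and it tends to 1.\<close>
    have "negligible (N \<union> {0, 2 * pi})"
      using N by (simp add: negligible_Un)
    then have "AE s in lebesgue. s \<notin> N \<union> {0, 2 * pi}"
      by (intro AE_not_in) (simp add: negligible_iff_null_sets)
    then have "AE s in circle_measure. s \<notin> N \<union> {0, 2 * pi}"
      by (subst AE_restrict_space_iff) auto
    then show "AE s in circle_measure. (\<lambda>n. (cmod (f s - h n s))\<^sup>2) \<longlonglongrightarrow> 0"
      using AE_space
    proof eventually_elim
      case (elim s)
      then have s: "0 < s" "s < 2 * pi" "s \<notin> N" by (auto simp: space_restrict_space)
      have "0 < sin (s / 2)" using s by (intro sin_gt_zero) auto
      then have "(cos (s / 2))\<^sup>2 < 1"
        using sin_cos_squared_add[of "s / 2"] zero_less_power[of "sin (s / 2)" 2] by linarith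
      then have "\<bar>cos (s / 2)\<bar> < 1"
        by (simp add: abs_square_less_1)
      then have "norm \<bar>cos (s / 2)\<bar> < 1"
        by (simp only: real_norm_def abs_idempotent)
      then have "(\<lambda>n. \<bar>cos (s / 2)\<bar> ^ n) \<longlonglongrightarrow> 0"
        by (rule LIMSEQ_power_zero)
      moreover have "(\<lambda>n. clip B (g n s)) \<longlonglongrightarrow> clip B (f s)"
        using lim[OF s(3)] s continuous_on_clip[OF B(1), of UNIV]
        by (intro isCont_tendsto_compose[of _ "clip B"])
           (auto simp: continuous_on_eq_continuous_at)
      ultimately have "(\<lambda>n. h n s) \<longlonglongrightarrow> of_real (1 - 0) * clip B (f s)"
        unfolding h_def by (intro tendsto_mult tendsto_of_real tendsto_diff tendsto_const)
      then have "(\<lambda>n. h n s) \<longlonglongrightarrow> f s"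
        by (simp add: clip_eq B)
      then have "(\<lambda>n. (cmod (f s - h n s))\<^sup>2) \<longlonglongrightarrow> (cmod (f s - f s))\<^sup>2"
        by (intro tendsto_intros)
      then show ?case by simp
    qed
  next
    fix n
    have "cmod (f s - h n s) \<le> 2 * B" for s
      using norm_triangle_ineq4[of "f s" "h n s"] B(2)[of s] bound[of n s] by linarith
    then have "(cmod (f s - h n s))\<^sup>2 \<le> (2 * B)\<^sup>2" for s
      by (intro power_mono) auto
    then show "AE s in circle_measure. norm ((cmod (f s - h n s))\<^sup>2) \<le> (2 * B)\<^sup>2"
      by simp
  qed auto
  then have "(\<lambda>n. mean_square (\<lambda>s. f s - h n s)) \<longlonglongrightarrow> 0"
    by (simp add: mean_square_def)
  with cont show thesis
    by (intro that[of h]) (auto simp: h_def)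
qed

text \<open>Three approximations are chained: \<open>f\<close> by its truncation \<open>u\<close>,
  \<open>u\<close> by a continuous \<open>v\<close> vanishing at both ends, \<open>v\<close> by a
  trigonometric polynomial \<open>p\<close>. With errors \<open>e / 8\<close>,
  \<open>e / 16\<close>, \<open>e / 16\<close>, two uses of \<open>mean_square_add_le\<close> bound
  the total by \<open>3 * e / 4\<close>.\<close>

lemma trig_polynomial_dense:
  assumes f: "L2 f" and e: "0 < e"
  obtains N c where "finite N" "mean_square (\<lambda>s. f s - (\<Sum>n\<in>N. c n * wave n s)) < e"
proof -
  obtain k where k: "mean_square (\<lambda>s. f s - clip (real (Suc k)) (f s)) < e / 8"
    using order_tendstoD(2)[OF mean_square_diff_clip[OF f], of "e / 8"] e
    by (auto simp: eventually_sequentially)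
  define u where "u s = clip (real (Suc k)) (f s)" for s
  note [measurable] = L2_measurable[OF f]
  have u [measurable]: "u \<in> borel_measurable circle_measure"
    unfolding u_def
    using borel_measurable_continuous_onI[OF continuous_on_clip[of "real (Suc k)"]] by measurable
  have ub: "cmod (u s) \<le> real (Suc k)" for s
    unfolding u_def by (intro cmod_clip_le) simp
  obtain g where g: "\<And>n. continuous_on UNIV (g n)" "\<And>n. g (Suc n) 0 = 0"
      "\<And>n. g (Suc n) (2 * pi) = 0" "(\<lambda>n. mean_square (\<lambda>s. u s - g n s)) \<longlonglongrightarrow> 0"
    using bounded_approximation[OF u _ ub] by (metis of_nat_0_less_iff zero_less_Suc)
  have "\<forall>\<^sub>F n in sequentially. mean_square (\<lambda>s. u s - g n s) < e / 16"
    using order_tendstoD(2)[OF g(4), of "e / 16"] e by simp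
  \<comment> \<open>The index is shifted because the vanishing at the ends is stated for
    \<open>g (Suc n)\<close>.\<close>
  then obtain n where n: "mean_square (\<lambda>s. u s - g (Suc n) s) < e / 16"
    by (auto simp: eventually_sequentially) (meson le_SucI order_refl)
  define v where "v = g (Suc n)"
  have v: "continuous_on {0..2 * pi} v" "v 0 = v (2 * pi)"
    using g(1)[of "Suc n"] by (auto simp: v_def g(2,3) intro: continuous_on_subset)
  \<comment> \<open>A uniform error \<open>r\<close> on an interval of length \<open>2 * pi\<close>
    has mean square at most \<open>r\<^sup>2 * (2 * pi)\<close>, set here to
    \<open>e / 16\<close>.\<close>
  define r where "r = sqrt (e / (32 * pi))"
  have r: "0 < r" "r\<^sup>2 * (2 * pi) = e / 16" using e by (auto simp: r_def)
  obtain p where p: "trig_polynomial p" "\<And>s. s \<in> {0..2 * pi} \<Longrightarrow> cmod (v s - p s) < r"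
    using trig_polynomial_uniform_approximation[OF v r(1)] by blast
  obtain N c where N: "finite N" "p = (\<lambda>s. \<Sum>n\<in>N. c n * wave n s)"
    using trig_polynomial_sum[OF p(1)] by blast
  have L2p: "L2 p" unfolding N by (rule L2_trig_sum)
  have L2u: "L2 u" by (rule L2_bounded[OF u ub])
  have L2v: "L2 v" by (rule L2_continuous[OF v(1)])
  have one: "L2 (\<lambda>_. 1)" "mean_square (\<lambda>_. 1) = 2 * pi"
    by (auto simp: L2_continuous mean_square_def measure_restrict_space)
  have "mean_square (\<lambda>s. v s - p s) \<le> e / 16"
    using L2_mult_bounded(2)[OF one(1) L2_measurable[OF L2_diff[OF L2v L2p]], of r] p(2) r(2)
    by (force simp: one(2) intro: less_imp_le)
  moreover have "mean_square (\<lambda>s. u s - p s)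
      \<le> 2 * mean_square (\<lambda>s. u s - v s) + 2 * mean_square (\<lambda>s. v s - p s)"
    using mean_square_add_le[OF L2_diff[OF L2u L2v] L2_diff[OF L2v L2p]] by simp
  moreover have "mean_square (\<lambda>s. f s - p s)
      \<le> 2 * mean_square (\<lambda>s. f s - u s) + 2 * mean_square (\<lambda>s. u s - p s)"
    using mean_square_add_le[OF L2_diff[OF f L2u] L2_diff[OF L2u L2p]] by simp
  ultimately have "mean_square (\<lambda>s. f s - p s) < e"
    using k n e unfolding u_def v_def by linarith
  with N that show thesis by blast
qed

section \<open>Unconditional convergence of weighted Fourier series\<close>

lemma fourier_series_tendsto:
  assumes f: "L2 f"
  shows "((\<lambda>N. mean_square (\<lambda>s. (\<Sum>n\<in>N. fourier_coeff f n * wave n s) - f s)) \<longlongrightarrow> 0)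
    (finite_subsets_at_top UNIV)"
proof (rule tendstoI)
  fix e :: real assume "0 < e"
  then obtain M c where M: "finite M" "mean_square (\<lambda>s. f s - (\<Sum>n\<in>M. c n * wave n s)) < e"
    using trig_polynomial_dense[OF f] by blast
  have "dist (mean_square (\<lambda>s. (\<Sum>n\<in>N. fourier_coeff f n * wave n s) - f s)) 0 < e"
    if N: "finite N" "M \<subseteq> N" for N
  proof -
    \<comment> \<open>Padding the coefficients by zero turns the fixed approximant over
      \<open>M\<close> into a competitor over any larger \<open>N\<close>, so best approximation
      gives the bound for all finite supersets of \<open>M\<close> at once.\<close>
    have "(\<Sum>n\<in>M. c n * wave n s) = (\<Sum>n\<in>N. (if n \<in> M then c n else 0) * wave n s)" for s
      using N by (intro sum.mono_neutral_cong_left) auto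
    then have "mean_square (\<lambda>s. f s - (\<Sum>n\<in>N. fourier_coeff f n * wave n s)) < e"
      using fourier_best_approximation[OF f N(1), of "\<lambda>n. if n \<in> M then c n else 0"] M(2) by simp
    then show ?thesis
      using mean_square_nonneg by (simp add: dist_real_def mean_square_def norm_minus_commute)
  qed
  with M(1) show "\<forall>\<^sub>F N in finite_subsets_at_top UNIV.
      dist (mean_square (\<lambda>s. (\<Sum>n\<in>N. fourier_coeff f n * wave n s) - f s)) 0 < e"
    by (auto simp: eventually_finite_subsets_at_top)
qed

text \<open>The weight \<open>h\<close> will be the factor \<open>y ^ m * exp (- m * P s)\<close> of
  a mode; being continuous on a compact interval, it is bounded.\<close>

lemma L2_bisums_fourier:
  assumes f: "L2 f" and h: "continuous_on {0..2 * pi} h"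
  shows "L2_bisums (\<lambda>n s. h s * (fourier_coeff f n * wave n s)) (\<lambda>s. h s * f s)"
proof -
  have hm: "h \<in> borel_measurable circle_measure"
    by (rule continuous_imp_circle_measurable[OF h])
  have "bounded (h ` {0..2 * pi})"
    using h by (intro compact_imp_bounded compact_continuous_image) auto
  then obtain K where K: "\<And>s. s \<in> {0..2 * pi} \<Longrightarrow> cmod (h s) \<le> K"
    unfolding bounded_iff by blast
  let ?S = "\<lambda>N s. \<Sum>n\<in>N. fourier_coeff f n * wave n s"
  have "((\<lambda>N. mean_square (\<lambda>s. h s * (?S N s - f s))) \<longlongrightarrow> 0) (finite_subsets_at_top UNIV)"
  proof (rule tendsto_sandwich[where f = "\<lambda>_. 0"
        and h = "\<lambda>N. K\<^sup>2 * mean_square (\<lambda>s. ?S N s - f s)"])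
    show "((\<lambda>N. K\<^sup>2 * mean_square (\<lambda>s. ?S N s - f s)) \<longlongrightarrow> 0) (finite_subsets_at_top UNIV)"
      using tendsto_mult_left[OF fourier_series_tendsto[OF f], of "K\<^sup>2"] by simp
    show "\<forall>\<^sub>F N in finite_subsets_at_top UNIV.
        mean_square (\<lambda>s. h s * (?S N s - f s)) \<le> K\<^sup>2 * mean_square (\<lambda>s. ?S N s - f s)"
      by (intro always_eventually allI L2_mult_bounded(2)[OF L2_diff[OF L2_trig_sum f] hm K])
    show "\<forall>\<^sub>F N in finite_subsets_at_top UNIV. 0 \<le> mean_square (\<lambda>s. h s * (?S N s - f s))"
      by (simp add: mean_square_nonneg)
  qed simp
  from tendsto_real_sqrt[OF this]
  have "((\<lambda>N. L2_norm (\<lambda>s. (\<Sum>n\<in>N. h s * (fourier_coeff f n * wave n s)) - h s * f s)) \<longlongrightarrow> 0)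
      (finite_subsets_at_top UNIV)"
    by (simp add: L2_norm_eq right_diff_distrib sum_distrib_left)
  moreover have "L2 (\<lambda>s. \<Sum>n\<in>N. h s * (fourier_coeff f n * wave n s))" for N
    using L2_mult_bounded(1)[OF L2_trig_sum hm K] by (simp add: sum_distrib_left)
  ultimately show ?thesis
    unfolding L2_bisums_def L2_tendsto_def
    using L2_mult_bounded(1)[OF f hm K] by simp
qed


section \<open>The Koopman modes\<close>

definition phase :: "(real \<Rightarrow> real) \<Rightarrow> real \<Rightarrow> real" where
  "phase A s = (LBINT z=0..s. A z - mean A)"

lemma mode_eq: "mode A m n (y, s) = of_real (y ^ m * exp (- real m * phase A s)) * wave n s"
  by (simp add: mode_def phase_def wave_def)

lemma phase_0 [simp]: "phase A 0 = 0"
  unfolding phase_def zero_ereal_def by (rule interval_integral_endpoints_same)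

lemma phase_deriv:
  assumes A: "continuous_on UNIV A"
  shows "(phase A has_real_derivative A s - mean A) (at s)"
proof -
  define a b where "a = min 0 s - 1" and "b = max 0 s + 1"
  have "((\<lambda>u. LBINT z=0..u. A z - mean A) has_vector_derivative A s - mean A) (at s within {a..b})"
    unfolding zero_ereal_def
    by (rule interval_integral_FTC2)
       (auto simp: a_def b_def intro!: continuous_intros continuous_on_subset[OF A])
  moreover have "at s within {a..b} = at s"
    by (rule at_within_Icc_at) (auto simp: a_def b_def)
  ultimately show ?thesis
    by (simp add: phase_def[abs_def] has_real_derivative_iff_has_vector_derivative)
qed

text \<open>The increment over one period has derivative 0 since \<open>A\<close> is periodic, so it
  equals its value at 0: the integral of \<open>A - mean A\<close> over a full period, which
  vanishes by the choice of \<open>mean A\<close>.\<close>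

lemma phase_periodic:
  assumes A: "continuous_on UNIV A" "periodic A"
  shows "phase A (s + 2 * pi) = phase A s"
proof -
  have "((\<lambda>s. phase A (s + 2 * pi) - phase A s) has_real_derivative 0) (at s)" for s
  proof -
    have "((\<lambda>s. phase A (s + 2 * pi)) has_real_derivative (A (s + 2 * pi) - mean A) * 1) (at s)"
      by (rule DERIV_chain2[OF phase_deriv[OF A(1)]]) (auto intro!: derivative_eq_intros)
    from DERIV_diff[OF this phase_deriv[OF A(1)]] show ?thesis
      using A(2) by (simp add: periodic_def)
  qed
  then have "phase A (s + 2 * pi) - phase A s = phase A (0 + 2 * pi) - phase A 0"
    using DERIV_isconst_all by blast
  also have "\<dots> = (LBINT z=0..2 * pi. A z) - (LBINT z=0..2 * pi. mean A)"
  proof -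
    have "interval_lebesgue_integrable lborel (ereal 0) (ereal (2 * pi)) A"
      by (intro interval_integrable_continuous_on continuous_on_subset[OF A(1)]) auto
    moreover have "interval_lebesgue_integrable lborel (ereal 0) (ereal (2 * pi)) (\<lambda>_. mean A)"
      by (rule interval_integral_const)
    ultimately show ?thesis
      using interval_lebesgue_integral_diff(2)[of lborel "ereal 0" "ereal (2 * pi)" A "\<lambda>_. mean A"]
      by (simp add: phase_def zero_ereal_def)
  qed
  also have "\<dots> = 0"
    using interval_integral_const(2)[of 0 "2 * pi" "mean A"]
    by (simp add: mean_def zero_ereal_def)
  finally show ?thesis by simp
qed

section \<open>The explicit flow and the eigenfunction equation\<close>

lemma flow_cycle_field:
  assumes A: "continuous_on UNIV A"
  shows "flow (cycle_field A) t (y, s)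
    = (y * exp (phase A (s + t) - phase A s + mean A * t), s + t)"
proof -
  \<comment> \<open>The exponent is the integral of \<open>A\<close> from \<open>s\<close> to
    \<open>s + t\<close>, split into a periodic part and linear growth. Uniqueness of solutions then
    identifies \<open>x\<close> with the flow line.\<close>
  define x where "x t = (y * exp (phase A (s + t) - phase A s + mean A * t), s + t)" for t
  have "solution (cycle_field A) (y, s) x"
    unfolding solution_def
  proof (intro conjI allI)
    fix t
    have "((\<lambda>t. phase A (s + t)) has_real_derivative (A (s + t) - mean A) * 1) (at t)"
      by (rule DERIV_chain2[OF phase_deriv[OF A]]) (auto intro!: derivative_eq_intros)
    then have "((\<lambda>t. y * exp (phase A (s + t) - phase A s + mean A * t)) has_real_derivative
        A (s + t) * (y * exp (phase A (s + t) - phase A s + mean A * t))) (at t)"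
      by (auto intro!: derivative_eq_intros)
    then have "(x has_vector_derivative
        (A (s + t) * (y * exp (phase A (s + t) - phase A s + mean A * t)), 1)) (at t)"
      unfolding x_def
      by (intro has_vector_derivative_Pair)
         (auto simp: has_real_derivative_iff_has_vector_derivative intro!: derivative_eq_intros)
    then show "(x has_vector_derivative cycle_field A (x t)) (at t)"
      by (simp add: x_def cycle_field_def)
  qed (simp add: x_def)
  then have "(THE x. solution (cycle_field A) (y, s) x) = x"
    by (rule the1_equality[OF ex1_solution[OF A]])
  then show ?thesis by (simp add: flow_def x_def)
qed

text \<open>Along the flow, \<open>y ^ m\<close> is multiplied by the exponential of
  \<open>m\<close> times the phase increment plus \<open>m * mean A * t\<close>. The factor
  \<open>exp (- m * P)\<close> cancels the increment, and the wave contributes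
  \<open>exp (\<i> * n * t)\<close>.\<close>

lemma koopman_eigenfunction_mode:
  assumes A: "continuous_on UNIV A" "periodic A"
  shows "koopman_eigenfunction (cycle_field A) (mode A m n)
    (of_nat m * of_real (mean A) + \<i> * of_int n)"
  unfolding koopman_eigenfunction_def
proof (intro conjI allI)
  have "wave n (s + 2 * pi) = wave n s" for s
    using exp_integer_2pi[of "of_int n"]
    by (simp add: wave_def algebra_simps exp_add)
  then show "observable (mode A m n)"
    by (simp add: observable_def periodic_def mode_eq phase_periodic[OF A])
  show "\<exists>p. mode A m n p \<noteq> 0"
    \<comment> \<open>At \<open>y = 1\<close> the power \<open>y ^ m\<close> is nonzero for every
      \<open>m\<close>.\<close>
    by (rule exI[of _ "(1, 0)"]) (simp add: mode_eq wave_def)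
  fix t
  show "koopman (cycle_field A) t (mode A m n)
      = (\<lambda>p. exp ((of_nat m * of_real (mean A) + \<i> * of_int n) * of_real t) * mode A m n p)"
  proof
    fix p :: "real \<times> real"
    obtain y s where p: "p = (y, s)" by (cases p)
    have "(y * exp (phase A (s + t) - phase A s + mean A * t)) ^ m * exp (- real m * phase A (s + t))
        = y ^ m * exp (real m * (phase A (s + t) - phase A s + mean A * t) - real m * phase A (s + t))"
      by (simp add: power_mult_distrib exp_of_nat_mult exp_diff exp_minus divide_inverse)
    also have "\<dots> = exp (real m * mean A * t) * (y ^ m * exp (- real m * phase A s))"
      by (simp add: algebra_simps flip: exp_add)
    finally have "(y * exp (phase A (s + t) - phase A s + mean A * t)) ^ m
        * exp (- real m * phase A (s + t))
        = exp (real m * mean A * t) * (y ^ m * exp (- real m * phase A s))" .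
    moreover have "wave n (s + t) = exp (\<i> * of_int n * of_real t) * wave n s"
      by (simp add: wave_def algebra_simps flip: exp_add)
    moreover have "exp ((of_nat m * of_real (mean A) + \<i> * of_int n) * of_real t)
        = of_real (exp (real m * mean A * t)) * exp (\<i> * of_int n * of_real t)"
      by (simp add: distrib_right exp_add flip: exp_of_real)
    ultimately show "koopman (cycle_field A) t (mode A m n) p
        = exp ((of_nat m * of_real (mean A) + \<i> * of_int n) * of_real t) * mode A m n p"
      by (simp only: koopman_def o_def p flow_cycle_field[OF A(1)] mode_eq of_real_mult mult_ac)
  qed
qed

section \<open>The double series\<close>

lemma mode_expansion:
  assumes A: "continuous_on UNIV A" and F: "analytic_L2 F"
  shows "\<exists>a. \<forall>y. L2_double_sums (\<lambda>m n s. a m n * mode A m n (y, s)) (\<lambda>s. F (y, s))"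
proof -
  obtain b where b: "\<And>m. L2 (b m)"
    and sums: "\<And>y. L2_sums (\<lambda>m s. b m s * of_real y ^ m) (\<lambda>s. F (y, s))"
    using F unfolding analytic_L2_def by blast
  have ph: "continuous_on S (phase A)" for S
    using phase_deriv[OF A] DERIV_isCont continuous_at_imp_continuous_on by blast
  \<comment> \<open>The factor \<open>exp (m * P)\<close> compensates in advance for the decay
    factor of the mode. The expansion coefficients are the Fourier coefficients of
    \<open>u m\<close>, so one family serves all \<open>y\<close>.\<close>
  define u where "u m s = of_real (exp (real m * phase A s)) * b m s" for m s
  have u: "L2 (u m)" for m
  proof -
    have cont: "continuous_on {0..2 * pi} (\<lambda>s. complex_of_real (exp (real m * phase A s)))"
      by (intro continuous_intros ph)
    then have "bounded ((\<lambda>s. complex_of_real (exp (real m * phase A s))) ` {0..2 * pi})"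
      by (intro compact_imp_bounded compact_continuous_image) auto
    then obtain K where "\<And>s. s \<in> {0..2 * pi} \<Longrightarrow> cmod (of_real (exp (real m * phase A s))) \<le> K"
      unfolding bounded_iff by blast
    then show ?thesis
      unfolding u_def by (rule L2_mult_bounded(1)[OF b continuous_imp_circle_measurable[OF cont]])
  qed
  have "L2_bisums (\<lambda>n s. fourier_coeff (u m) n * mode A m n (y, s)) (\<lambda>s. b m s * of_real y ^ m)"
    for m y
  proof -
    have "continuous_on {0..2 * pi} (\<lambda>s. complex_of_real (y ^ m * exp (- real m * phase A s)))"
      by (intro continuous_intros ph)
    from L2_bisums_fourier[OF u[of m] this] show ?thesis
      by (simp add: mode_eq u_def mult_ac exp_minus field_simps flip: of_real_mult)
  qed
  note bisums = this
  show ?thesis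
    unfolding L2_double_sums_def
  proof (intro exI allI conjI)
    \<comment> \<open>The inner sums are taken to be the terms \<open>b m s * y ^ m\<close>, so the
      outer sum over \<open>m\<close> is the power series of \<open>F\<close> itself.\<close>
    show "L2_bisums (\<lambda>n s. fourier_coeff (u m) n * mode A m n (y, s))
        (\<lambda>s. b m s * of_real y ^ m)" for m y
      by (rule bisums)
  qed (rule sums)
qed

theorem theorem7p1:
  fixes A :: "real \<Rightarrow> real"
  assumes "continuous_on UNIV A" and "periodic A"
  shows "(\<forall>F. analytic_L2 F \<longrightarrow>
            (\<exists>a :: nat \<Rightarrow> int \<Rightarrow> complex. \<forall>y.
               L2_double_sums (\<lambda>m n s. a m n * mode A m n (y, s)) (\<lambda>s. F (y, s)))) \<and>
         (\<forall>m n. koopman_eigenfunction (cycle_field A) (mode A m n)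
            (of_nat m * of_real (mean A) + \<i> * of_int n))"
  using mode_expansion[OF assms(1)] koopman_eigenfunction_mode[OF assms] by blast

end
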